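(* Consider the nonparametric current status model: $(V_i,\Delta_i)$, $i=1,\dots,n$, are i.i.d. copies of $(V,\Delta)$ with $\Delta=\mathbf 1_{(U\le V)}$, where $U$ and $V$ are independent real random variables and $U$ has unknown distribution function $G_0$. Assume that the support of $V$ is an interval $[l_v,u_v]$ with $-\infty<l_v<u_v<\infty$, that $G_0$ is continuous with $0<G_0(l_v)\le G_0(u_v)<1$, and that the distribution of $V$ is continuous. Let $\widehat G_n$ be the nonparametric maximum likelihood estimator of $G_0$, and assume that $\Delta_{(1)}=1$ and $\Delta_{(n)}=0$ (i.e., the probabilities below are taken conditionally on this event). Then: (i) for any $\epsilon\in(0,G_0(l_v))$, $\liminf_{n\to\infty}P\{\widehat G_n(V_{(1)})\le G_0(l_v)-\epsilon\}>0$; and (ii) for any $\epsilon\in(0,1-G_0(u_v))$, $\liminf_{n\to\infty}P\{\widehat G_n(V_{(n)})\ge G_0(u_v)+\epsilon\}>0$.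
   Context: $V_{(1)}\le\dots\le V_{(n)}$ are the order statistics of $V_1,\dots,V_n$, and $\Delta_{(i)}$ is the status indicator attached to $V_{(i)}$. The nonparametric maximum likelihood estimator $\widehat G_n$ maximizes $\sum_{i=1}^n\{\Delta_i\log G(V_i)+(1-\Delta_i)\log(1-G(V_i))\}$ over all nondecreasing functions $G$ with values in $[0,1]$ (convention $0\log0=0$); no penalization and no covariates are involved. *)

theory Defs
  imports "HOL-Probability.Probability"
begin

definition topological_support :: "'a::topological_space measure \<Rightarrow> 'a set" where
  "topological_support \<mu> = {x. \<forall>S. open S \<and> x \<in> S \<longrightarrow> 0 < emeasure \<mu> S}"

(* The observations number 0, ..., n - 1, ordered by the examination times v i, each time carrying
   its status indicator d i.  Observations with equal times keep their original order. *)
definition ordered_sample :: "nat \<Rightarrow> (nat \<Rightarrow> real) \<Rightarrow> (nat \<Rightarrow> bool) \<Rightarrow> (real \<times> bool) list" where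
  "ordered_sample n v d = sort_key fst (map (\<lambda>i. (v i, d i)) [0..<n])"

(* Ranks k run from 1 to n; the values for other k are irrelevant. *)
definition order_stat :: "nat \<Rightarrow> (nat \<Rightarrow> real) \<Rightarrow> (nat \<Rightarrow> bool) \<Rightarrow> nat \<Rightarrow> real" where
  "order_stat n v d k = fst (ordered_sample n v d ! (k - 1))"

definition order_status :: "nat \<Rightarrow> (nat \<Rightarrow> real) \<Rightarrow> (nat \<Rightarrow> bool) \<Rightarrow> nat \<Rightarrow> bool" where
  "order_status n v d k = snd (ordered_sample n v d ! (k - 1))"

(* The library's real ln satisfies ln 0 = 0; the likelihood needs log 0 = -\<infinity>. *)
definition elog :: "real \<Rightarrow> ereal" where
  "elog x = (if 0 < x then ereal (ln x) else -\<infinity>)"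

(* In ereal, 0 * (-\<infinity>) = 0, which is the convention 0 log 0 = 0.  For G with values in [0, 1] no
   summand is +\<infinity>, so the sum is the intended one. *)
definition log_likelihood :: "nat \<Rightarrow> (nat \<Rightarrow> real) \<Rightarrow> (nat \<Rightarrow> bool) \<Rightarrow> (real \<Rightarrow> real) \<Rightarrow> ereal" where
  "log_likelihood n v d G =
     (\<Sum>i<n. of_bool (d i) * elog (G (v i)) + (1 - of_bool (d i)) * elog (1 - G (v i)))"

definition npmle_candidates :: "(real \<Rightarrow> real) set" where
  "npmle_candidates = {G. mono G \<and> (\<forall>x. G x \<in> {0..1})}"

(* A maximizer is determined at the observed times only, hence a predicate and not a function. *)
definition is_npmle :: "nat \<Rightarrow> (nat \<Rightarrow> real) \<Rightarrow> (nat \<Rightarrow> bool) \<Rightarrow> (real \<Rightarrow> real) \<Rightarrow> bool" where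
  "is_npmle n v d G \<longleftrightarrow>
     G \<in> npmle_candidates \<and>
     (\<forall>H\<in>npmle_candidates. log_likelihood n v d H \<le> log_likelihood n v d G)"

end

theory Submission
  imports Defs
begin

text \<open>
  At the smallest examination time the NPMLE is the minimum, over the observed times t, of the mean
  of the status indicators with examination time at most t; reflecting times and indicators gives
  the largest time.  Hence, if the first K indicators are 1, 0, ..., 0, the estimate at the
  smallest time is at most 1/K.  Given the examination times, the indicators are independent and
  each of them takes any prescribed value with probability at least
  r = min (G0(lv)) (1 - G0(uv)) > 0, so this pattern together with a last indicator 0 has
  probability at least r^(K+1), whatever the sample size.  Passing to the conditional probability
  can only increase it, since the pattern implies the conditioning event.
\<close>

text \<open>\<open>Ghat\<close> is an arbitrary selection of maximizers whose dependence on the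
  sample point need not be measurable, and a non-measurable set has measure 0 by convention. A mere
  upper bound for the estimate at the smallest time would therefore not suffice. The two
  inequalities proved there identify the event exactly, as one about finitely many initial means,
  and that event is measurable. Each inequality comes from the first-order condition along an
  explicit competitor, so the shape of the estimate at other times is never computed.

  The pattern is phrased by ranks, because which observation has a given rank is random. Once
  distinct times are fixed, ranks are deterministic, and a prescribed status at a rank only asks one
  variable \<open>U\<close> to lie in \<open>{..lv}\<close> or in \<open>{uv<..}\<close>. These
  half-lines do not depend on the times, and unconstrained observations contribute the factor 1, so
  the bound depends on the number of prescribed ranks and not on the sample size. The constant K
  comes from 1/K \<le> G0(lv) - \<epsilon>, and from 1/K \<le> 1 - G0(uv) - \<epsilon> at the other
  end.\<close>

section \<open>Likelihood contributions and the first-order condition\<close>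

definition obs_prob :: "(nat \<Rightarrow> real) \<Rightarrow> (nat \<Rightarrow> bool) \<Rightarrow> (real \<Rightarrow> real) \<Rightarrow> nat \<Rightarrow> real" where
  "obs_prob v d G i = (if d i then G (v i) else 1 - G (v i))"

text \<open>Since 0 * (-\<infinity>) = 0, the inactive term of each summand vanishes and one
  \<open>elog\<close> per observation remains. Its argument \<open>obs_prob\<close> is affine in
  \<open>G\<close>, which the differentiation along segments relies on.\<close>

lemma log_likelihood_obs_prob:
  "log_likelihood n v d G = (\<Sum>i<n. elog (obs_prob v d G i))"
  unfolding log_likelihood_def obs_prob_def by (intro sum.cong) auto

lemma log_likelihood_finite:
  assumes "\<And>i. i < n \<Longrightarrow> 0 < obs_prob v d G i"
  shows "log_likelihood n v d G = ereal (\<Sum>i<n. ln (obs_prob v d G i))"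
proof -
  have "log_likelihood n v d G = (\<Sum>i<n. ereal (ln (obs_prob v d G i)))"
    unfolding log_likelihood_obs_prob using assms by (intro sum.cong) (auto simp: elog_def)
  then show ?thesis by simp
qed

lemma candidateD:
  assumes "G \<in> npmle_candidates"
  shows "0 \<le> G x" "G x \<le> 1" "x \<le> y \<Longrightarrow> G x \<le> G y"
  using assms by (auto simp: npmle_candidates_def dest: monoD)

lemma obs_prob_nonneg: "G \<in> npmle_candidates \<Longrightarrow> 0 \<le> obs_prob v d G i"
  by (simp add: obs_prob_def candidateD)

text \<open>The constant candidate 1/2 has finite likelihood, so a maximizer has likelihood above
  -\<infinity>. A vanishing contribution would force -\<infinity>, as no other summand can be
  \<infinity> to compensate. This makes all later divisions by \<open>obs_prob\<close>
  legitimate.\<close>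

lemma npmle_obs_prob_pos:
  assumes "is_npmle n v d G" "i < n"
  shows "0 < obs_prob v d G i"
proof (rule ccontr)
  assume np: "\<not> 0 < obs_prob v d G i"
  have "(\<lambda>_. 1/2) \<in> npmle_candidates"
    by (auto simp: npmle_candidates_def mono_def)
  then have "log_likelihood n v d (\<lambda>_. 1/2) \<le> log_likelihood n v d G"
    using assms(1) by (simp add: is_npmle_def)
  moreover have "log_likelihood n v d (\<lambda>_. 1/2) > -\<infinity>"
    by (subst log_likelihood_finite) (auto simp: obs_prob_def)
  moreover have "log_likelihood n v d G = -\<infinity>"
  proof -
    have "(\<Sum>j<n. elog (obs_prob v d G j)) = elog (obs_prob v d G i) + (\<Sum>j\<in>{..<n}-{i}. elog (obs_prob v d G j))"
      using assms(2) by (intro sum.remove) auto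
    moreover have "(\<Sum>j\<in>{..<n}-{i}. elog (obs_prob v d G j)) \<noteq> \<infinity>"
      by (subst sum_Pinfty) (auto simp: elog_def)
    ultimately show ?thesis
      using np by (simp add: log_likelihood_obs_prob elog_def)
  qed
  ultimately show False by simp
qed

text \<open>First-order condition at the maximizer, along the segment from G towards H.\<close>

lemma npmle_score_le_0:
  assumes G: "is_npmle n v d G" and H: "H \<in> npmle_candidates"
  shows "(\<Sum>i<n. (obs_prob v d H i - obs_prob v d G i) / obs_prob v d G i) \<le> 0"
proof (rule ccontr)
  let ?p = "obs_prob v d G" and ?q = "obs_prob v d H"
  let ?f = "\<lambda>t. \<Sum>i<n. ln (?p i + t * (?q i - ?p i))"
  assume "\<not> ?thesis"
  then have pos: "0 < (\<Sum>i<n. (?q i - ?p i) / ?p i)" by simp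
  have p: "0 < ?p i" if "i < n" for i using npmle_obs_prob_pos[OF G that] .
  have "(?f has_real_derivative (\<Sum>i<n. (?q i - ?p i) / ?p i)) (at 0)"
    by (rule derivative_eq_intros refl | use p in force)+
  from DERIV_pos_inc_right[OF this pos]
  obtain e where e: "e > 0" "\<And>t. 0 < t \<Longrightarrow> t < e \<Longrightarrow> ?f 0 < ?f (0 + t)" by blast
  \<comment> \<open>Staying below 1 keeps a positive share of \<open>G\<close> in the mixture, so
    every contribution remains positive even where that of \<open>H\<close> vanishes.\<close>
  define t where "t = min (e/2) (1/2)"
  have t: "0 < t" "t < e" "t < 1" using e(1) by (auto simp: t_def)
  let ?G = "\<lambda>x. (1-t) * G x + t * H x"
  have Gc: "G \<in> npmle_candidates" using G by (simp add: is_npmle_def)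
  have cand: "?G \<in> npmle_candidates"
  proof -
    have "mono ?G" using t by (intro monoI add_mono mult_left_mono candidateD[OF Gc] candidateD[OF H]) auto
    moreover have "0 \<le> ?G x \<and> ?G x \<le> 1" for x
      using t candidateD[OF Gc] candidateD[OF H] by (auto intro!: convex_bound_le)
    ultimately show ?thesis by (auto simp: npmle_candidates_def)
  qed
  have r: "obs_prob v d ?G i = ?p i + t * (?q i - ?p i)" for i
    by (simp add: obs_prob_def algebra_simps)
  have "0 < obs_prob v d ?G i" if "i < n" for i
  proof -
    have "0 < (1-t) * ?p i" using p[OF that] t by simp
    moreover have "0 \<le> t * ?q i" using t obs_prob_nonneg[OF H] by simp
    ultimately show ?thesis unfolding r by (simp add: algebra_simps)
  qed
  then have "log_likelihood n v d ?G = ereal (?f t)"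
    by (subst log_likelihood_finite) (auto simp: r)
  moreover have "log_likelihood n v d G = ereal (?f 0)"
    by (subst log_likelihood_finite) (auto simp: p)
  moreover have "log_likelihood n v d ?G \<le> log_likelihood n v d G"
    using G cand by (simp add: is_npmle_def)
  ultimately show False using e(2)[OF t(1,2)] by simp
qed

section \<open>The estimate at an extreme observed time\<close>

text \<open>This is the slope of the chord from the origin to a point of the cumulative sum diagram
  of the indicators; the smallest such slope is the initial slope of its greatest convex minorant.
  All observations tied with \<open>j\<close> are included.\<close>

definition initial_mean :: "nat \<Rightarrow> (nat \<Rightarrow> real) \<Rightarrow> (nat \<Rightarrow> bool) \<Rightarrow> nat \<Rightarrow> real" where
  "initial_mean n v d j = real (card {i\<in>{..<n}. v i \<le> v j \<and> d i}) / real (card {i\<in>{..<n}. v i \<le> v j})"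

text \<open>The sum is the score of a constant value a on the block. Each summand equals
  (\<open>of_bool (d i)\<close> - a) / (a (1 - a)), so the sum has the sign of the block mean minus
  a.\<close>

lemma initial_mean_le_iff:
  assumes "j < n" "a < 1" "0 < a"
  shows "initial_mean n v d j \<le> a \<longleftrightarrow> (\<Sum>i\<in>{i\<in>{..<n}. v i \<le> v j}. if d i then 1/a else -1/(1-a)) \<le> 0"
    and "a \<le> initial_mean n v d j \<longleftrightarrow> 0 \<le> (\<Sum>i\<in>{i\<in>{..<n}. v i \<le> v j}. if d i then 1/a else -1/(1-a))"
proof -
  let ?A = "{i\<in>{..<n}. v i \<le> v j}"
  let ?N1 = "real (card {i\<in>{..<n}. v i \<le> v j \<and> d i})"
  let ?N = "real (card ?A)"
  have split: "(\<Sum>i\<in>?A. if d i then 1/a else -1/(1-a)) = (?N1 - a * ?N) / (a * (1-a))"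
  proof -
    have "(\<Sum>i\<in>?A. if d i then 1/a else -1/(1-a)) = (\<Sum>i\<in>?A. (of_bool (d i) - a) / (a * (1-a)))"
      using assms by (intro sum.cong) (auto simp: field_simps)
    also have "\<dots> = ((\<Sum>i\<in>?A. of_bool (d i)) - a * ?N) / (a * (1-a))"
      by (simp add: sum_divide_distrib[symmetric] sum_subtractf)
    also have "(\<Sum>i\<in>?A. of_bool (d i)) = ?N1"
      by (subst sum_of_bool_eq) (auto intro!: arg_cong[where f=card])
    finally show ?thesis .
  qed
  have N: "0 < ?N" using assms(1) by (auto simp: card_gt_0_iff)
  have D: "0 < a * (1-a)" using assms by simp
  show "initial_mean n v d j \<le> a \<longleftrightarrow> (\<Sum>i\<in>?A. if d i then 1/a else -1/(1-a)) \<le> 0"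
    unfolding split initial_mean_def using N D
    by (simp add: divide_le_0_iff pos_divide_le_eq)
  show "a \<le> initial_mean n v d j \<longleftrightarrow> 0 \<le> (\<Sum>i\<in>?A. if d i then 1/a else -1/(1-a))"
    unfolding split initial_mean_def using N D
    by (simp add: zero_le_divide_iff pos_le_divide_eq)
qed

text \<open>Lowering \<open>G\<close> on the initial block up to \<open>v j\<close> keeps it
  monotone, so the score in that direction is at most 0. As \<open>G\<close> is at least a =
  \<open>G (v m)\<close> on the block, replacing its values there by a only decreases the score, and
  the sign of the resulting constant-value score compares a with the mean. The boundary values 0 and
  1 of a are treated apart, because the score divides by a and 1 - a.\<close>

lemma npmle_at_Min_le:
  assumes G: "is_npmle n v d G" and m: "m < n" "\<And>i. i < n \<Longrightarrow> v m \<le> v i" and j: "j < n"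
  shows "G (v m) \<le> initial_mean n v d j"
proof -
  let ?A = "{i\<in>{..<n}. v i \<le> v j}"
  define a where "a = G (v m)"
  have Gc: "G \<in> npmle_candidates" using G by (simp add: is_npmle_def)
  have ge: "a \<le> G (v i)" if "i < n" for i using candidateD(3)[OF Gc] m(2)[OF that] a_def by simp
  have mean1: "initial_mean n v d j = 1" if "\<forall>i<n. d i"
  proof -
    have "{i\<in>{..<n}. v i \<le> v j \<and> d i} = ?A" using that by auto
    moreover have "real (card ?A) \<noteq> 0" using j by auto
    ultimately show ?thesis unfolding initial_mean_def
      by (simp only: divide_self not_False_eq_True)
  qed
  have "0 \<le> a" "a \<le> 1" using candidateD[OF Gc] a_def by auto
  then consider "a = 0" | "a = 1" | "0 < a" "a < 1" by linarith
  then show ?thesis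
  proof cases
    case 1 then show ?thesis by (simp add: a_def[symmetric] initial_mean_def)
  next
    case 2
    have "d i" if "i < n" for i
      using npmle_obs_prob_pos[OF G that] ge[OF that] 2 candidateD(2)[OF Gc, of "v i"]
      by (auto simp: obs_prob_def split: if_splits)
    then show ?thesis using mean1 2 by (simp add: a_def)
  next
    case 3
    \<comment> \<open>lower the values on the initial block by a; since G is at least a there, the maximum with 0
        only affects unobserved times\<close>
    let ?H = "\<lambda>x. if x \<le> v j then max 0 (G x - a) else G x"
    have H: "?H \<in> npmle_candidates"
    proof -
      have "?H x \<le> ?H y" if "x \<le> y" for x y
        using candidateD(3)[OF Gc that] candidateD(1)[OF Gc, of y] that 3(1) by auto
      moreover have "0 \<le> ?H x" "?H x \<le> 1" for x
        using candidateD(1,2)[OF Gc, of x] 3(1) by auto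
      ultimately show ?thesis by (simp add: npmle_candidates_def mono_def)
    qed
    have "(\<Sum>i\<in>?A. if d i then -a / G (v i) else a / (1 - G (v i))) =
        (\<Sum>i<n. (obs_prob v d ?H i - obs_prob v d G i) / obs_prob v d G i)"
      using ge by (intro sum.mono_neutral_cong_left) (auto simp: obs_prob_def max_def)
    also have "\<dots> \<le> 0" by (rule npmle_score_le_0[OF G H])
    finally have le: "(\<Sum>i\<in>?A. if d i then -a / G (v i) else a / (1 - G (v i))) \<le> 0" .
    \<comment> \<open>Termwise comparison with the score at the constant a: both -a/g and a/(1 - g)
      increase with g, and g = \<open>G (v i)\<close> is at least a.\<close>
    have "(\<Sum>i\<in>?A. - a * (if d i then 1/a else -1/(1-a))) \<le> (\<Sum>i\<in>?A. if d i then -a / G (v i) else a / (1 - G (v i)))"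
    proof (rule sum_mono)
      fix i assume "i \<in> ?A"
      then have i: "i < n" by simp
      show "- a * (if d i then 1/a else -1/(1-a)) \<le> (if d i then -a / G (v i) else a / (1 - G (v i)))"
      proof (cases "d i")
        case True
        then have "a / G (v i) \<le> 1" using ge[OF i] 3 by simp
        then show ?thesis using True 3 by simp
      next
        case False
        then have "G (v i) < 1" using npmle_obs_prob_pos[OF G i] by (simp add: obs_prob_def)
        then have "a / (1 - a) \<le> a / (1 - G (v i))" using ge[OF i] 3 by (intro divide_left_mono) simp_all
        then show ?thesis using False by simp
      qed
    qed
    then have "- a * (\<Sum>i\<in>?A. (if d i then 1/a else -1/(1-a))) \<le> 0"
      using le by (simp only: sum_distrib_left)
    then have "0 \<le> (\<Sum>i\<in>?A. (if d i then 1/a else -1/(1-a)))"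
      using 3 by (simp add: zero_le_mult_iff)
    then show ?thesis using initial_mean_le_iff(2)[OF j 3(2,1)] by (simp add: a_def)
  qed
qed

text \<open>The witness is the last observation at which \<open>G\<close> still has its lowest
  observed value a. By monotonicity its initial block is exactly this level set, so \<open>G\<close>
  is constant there and raising it slightly is an admissible direction; the first-order condition
  then bounds the block mean by a.\<close>

lemma npmle_at_Min_ge:
  assumes G: "is_npmle n v d G" and m: "m < n" "\<And>i. i < n \<Longrightarrow> v m \<le> v i"
  shows "\<exists>j<n. initial_mean n v d j \<le> G (v m)"
proof -
  define a where "a = G (v m)"
  have Gc: "G \<in> npmle_candidates" using G by (simp add: is_npmle_def)
  have ge: "a \<le> G (v i)" if "i < n" for i using candidateD(3)[OF Gc] m(2)[OF that] a_def by simp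
  define B where "B = {i\<in>{..<n}. G (v i) = a}"
  have "finite (v ` B)" "v ` B \<noteq> {}" using m(1) by (auto simp: B_def a_def)
  then obtain j where j: "j \<in> B" "\<And>i. i \<in> B \<Longrightarrow> v i \<le> v j"
  proof -
    obtain j where "j \<in> B" "v j = Max (v ` B)"
      using Max_in[OF \<open>finite (v ` B)\<close> \<open>v ` B \<noteq> {}\<close>] by (metis imageE)
    then show thesis using that \<open>finite (v ` B)\<close> by simp
  qed
  let ?A = "{i\<in>{..<n}. v i \<le> v j}"
  have jn: "j < n" "G (v j) = a" using j(1) by (auto simp: B_def)
  have A: "?A = B"
  proof (intro set_eqI iffI)
    fix i assume i: "i \<in> ?A"
    then show "i \<in> B"
      using ge[of i] jn(2) candidateD(3)[OF Gc, of "v i" "v j"] by (simp add: B_def)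
  next
    fix i assume "i \<in> B"
    then show "i \<in> ?A" using j(2)[of i] by (simp add: B_def)
  qed
  have GA: "G (v i) = a" if "i \<in> ?A" for i using that unfolding A by (simp add: B_def)
  have "0 \<le> a" "a \<le> 1" using candidateD[OF Gc] a_def by auto
  then consider "a = 0" | "a = 1" | "0 < a" "a < 1" by linarith
  then have "initial_mean n v d j \<le> a"
  proof cases
    case 1
    have "\<not> d i" if "i \<in> ?A" for i
      using npmle_obs_prob_pos[OF G, of i] that GA[OF that] 1
      by (auto simp: obs_prob_def split: if_splits)
    then have "{i\<in>{..<n}. v i \<le> v j \<and> d i} = {}" by auto
    then show ?thesis using 1 unfolding initial_mean_def by (simp only: ) simp
  next
    case 2
    have "card {i\<in>{..<n}. v i \<le> v j \<and> d i} \<le> card ?A" by (intro card_mono) auto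
    then show ?thesis using 2 unfolding initial_mean_def
      by (cases "card ?A = 0") (simp_all only: divide_le_eq_1_pos of_nat_0_less_iff neq0_conv of_nat_le_iff of_nat_0 div_by_0 zero_le_one)
  next
    case 3
    \<comment> \<open>raise G on its lowest level set to the next observed level\<close>
    define b where "b = Min (insert 1 ((\<lambda>i. G (v i)) ` ({..<n} - B)))"
    have b1: "b \<le> 1" unfolding b_def by (intro Min_le) auto
    have bB: "b \<le> G (v i)" if "i < n" "i \<notin> B" for i
      unfolding b_def using that by (intro Min_le) auto
    \<comment> \<open>The inserted 1 keeps the minimum defined when the level set is the whole
      sample; strictness then rests on a < 1.\<close>
    have ba: "a < b"
      unfolding b_def using 3 ge by (subst Min_gr_iff) (auto simp: B_def order_less_le)
    let ?H = "\<lambda>x. max b (G x)"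
    have H: "?H \<in> npmle_candidates"
    proof -
      have "?H x \<le> ?H y" if "x \<le> y" for x y
        using candidateD(3)[OF Gc that] by auto
      moreover have "0 \<le> ?H x" "?H x \<le> 1" for x
        using candidateD(1,2)[OF Gc, of x] b1 by auto
      ultimately show ?thesis by (simp add: npmle_candidates_def mono_def)
    qed
    have "(b - a) * (\<Sum>i\<in>?A. (if d i then 1/a else -1/(1-a))) =
       (\<Sum>i\<in>?A. (b - a) * (if d i then 1/a else -1/(1-a)))" by (simp only: sum_distrib_left)
    also have "\<dots> = (\<Sum>i<n. (obs_prob v d ?H i - obs_prob v d G i) / obs_prob v d G i)"
    proof (intro sum.mono_neutral_cong_left ballI)
      fix i assume "i \<in> {..<n} - ?A"
      then show "(obs_prob v d ?H i - obs_prob v d G i) / obs_prob v d G i = 0"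
        using bB[of i] unfolding A by (simp add: obs_prob_def max_absorb2)
    next
      fix i assume "i \<in> ?A"
      then show "(b - a) * (if d i then 1/a else -1/(1-a)) = (obs_prob v d ?H i - obs_prob v d G i) / obs_prob v d G i"
        using GA[of i] ba 3 by (auto simp: obs_prob_def field_simps)
    qed auto
    also have "\<dots> \<le> 0" by (rule npmle_score_le_0[OF G H])
    finally have "(\<Sum>i\<in>?A. (if d i then 1/a else -1/(1-a))) \<le> 0"
      using ba by (simp add: mult_le_0_iff)
    then show ?thesis using initial_mean_le_iff(1)[OF jn(1) 3(2,1)] by simp
  qed
  then show ?thesis using jn a_def by auto
qed

text \<open>The right-hand side depends on the data only and not on the chosen maximizer, so it can
  be used to show measurability of the event on the left.\<close>

lemma npmle_at_Min_le_iff: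
  assumes "is_npmle n v d G" "m < n" "\<And>i. i < n \<Longrightarrow> v m \<le> v i"
  shows "G (v m) \<le> c \<longleftrightarrow> (\<exists>j<n. initial_mean n v d j \<le> c)"
  using npmle_at_Min_le[OF assms] npmle_at_Min_ge[OF assms] by force

text \<open>The map H \<mapsto> 1 - H(-x) is an involution on the candidates, and it exchanges the
  two kinds of likelihood contributions when times change sign and statuses are negated. Statements
  about the largest time thus reduce to the smallest.\<close>

lemma is_npmle_reflect:
  assumes "is_npmle n v d G"
  shows "is_npmle n (\<lambda>i. - v i) (\<lambda>i. \<not> d i) (\<lambda>x. 1 - G (- x))"
proof -
  have ref: "(\<lambda>x. 1 - H (- x)) \<in> npmle_candidates" if "H \<in> npmle_candidates" for H
    using that by (auto simp: npmle_candidates_def mono_def)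
  have lik: "log_likelihood n (\<lambda>i. - v i) (\<lambda>i. \<not> d i) H = log_likelihood n v d (\<lambda>x. 1 - H (- x))" for H
    by (simp add: log_likelihood_obs_prob obs_prob_def if_distrib cong: if_cong)
      (auto intro!: sum.cong)
  show ?thesis using assms ref unfolding is_npmle_def lik by simp
qed

lemma npmle_at_Max_ge_iff:
  assumes "is_npmle n v d G" "m < n" "\<And>i. i < n \<Longrightarrow> v i \<le> v m"
  shows "c \<le> G (v m) \<longleftrightarrow> (\<exists>j<n. initial_mean n (\<lambda>i. - v i) (\<lambda>i. \<not> d i) j \<le> 1 - c)"
  using npmle_at_Min_le_iff[OF is_npmle_reflect[OF assms(1)] assms(2), of "1 - c"] assms(3) by simp

section \<open>Order statistics, ranks and status patterns\<close>

lemma map_insort_key: "map f (insort_key (g \<circ> f) x xs) = insort_key g (f x) (map f xs)"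
  by (induction xs) auto

lemma map_sort_key: "map f (sort_key (g \<circ> f) xs) = sort_key g (map f xs)"
  by (induction xs) (simp_all add: map_insort_key[unfolded comp_def] comp_def)

text \<open>Sorting indices instead of pairs makes each order statistic and its status the values of
  \<open>v\<close> and \<open>d\<close> at one common index.\<close>

lemma ordered_sample_eq:
  "ordered_sample n v d = map (\<lambda>i. (v i, d i)) (sort_key v [0..<n])"
proof -
  have "v = fst \<circ> (\<lambda>i. (v i, d i))" by (simp add: comp_def)
  then show ?thesis unfolding ordered_sample_def by (metis map_sort_key)
qed

lemma order_stat_eq:
  "1 \<le> k \<Longrightarrow> k \<le> n \<Longrightarrow> order_stat n v d k = v (sort_key v [0..<n] ! (k - 1))"
  by (simp add: order_stat_def ordered_sample_eq)

lemma order_status_eq: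
  "1 \<le> k \<Longrightarrow> k \<le> n \<Longrightarrow> order_status n v d k = d (sort_key v [0..<n] ! (k - 1))"
  by (simp add: order_status_def ordered_sample_eq)

lemma sort_key_nth_less: "k < n \<Longrightarrow> sort_key v [0..<n] ! k < n"
  using nth_mem[of k "sort_key v [0..<n]"] by auto

lemma sort_key_nth_bounds:
  fixes v :: "nat \<Rightarrow> real"
  assumes "i < n"
  shows "v (sort_key v [0..<n] ! 0) \<le> v i" "v i \<le> v (sort_key v [0..<n] ! (n - 1))"
proof -
  let ?xs = "sort_key v [0..<n]"
  have "i \<in> set ?xs" using assms by simp
  then obtain k where k: "k < n" "?xs ! k = i"
    by (metis in_set_conv_nth length_sort length_upt minus_nat.diff_0)
  have s: "sorted (map v ?xs)" by simp
  show "v (?xs ! 0) \<le> v i"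
    using sorted_nth_mono[OF s, of 0 k] k by simp
  show "v i \<le> v (?xs ! (n - 1))"
    using sorted_nth_mono[OF s, of k "n - 1"] k by simp
qed

text \<open>Ranks start at 1, like the argument of \<open>order_stat\<close>. Counting avoids any
  reference to the sorting algorithm; tied observations share the largest rank of their
  group.\<close>

definition obs_rank :: "nat \<Rightarrow> (nat \<Rightarrow> real) \<Rightarrow> nat \<Rightarrow> nat" where
  "obs_rank n v i = card {j\<in>{..<n}. v j \<le> v i}"

lemma obs_rank_le_iff:
  assumes "i < n" "j < n"
  shows "obs_rank n v i \<le> obs_rank n v j \<longleftrightarrow> v i \<le> v j"
proof
  assume "v i \<le> v j"
  then show "obs_rank n v i \<le> obs_rank n v j"
    unfolding obs_rank_def by (intro card_mono) auto
next
  assume le: "obs_rank n v i \<le> obs_rank n v j"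
  show "v i \<le> v j"
  proof (rule ccontr)
    assume "\<not> v i \<le> v j"
    then have "{k\<in>{..<n}. v k \<le> v j} \<subset> {k\<in>{..<n}. v k \<le> v i}"
      using assms by (auto simp: psubset_eq)
    then have "obs_rank n v j < obs_rank n v i"
      unfolding obs_rank_def by (intro psubset_card_mono) auto
    with le show False by simp
  qed
qed

lemma obs_rank_in_range: "i < n \<Longrightarrow> obs_rank n v i \<in> {1..n}"
proof -
  assume i: "i < n"
  have "card {j\<in>{..<n}. v j \<le> v i} \<le> card {..<n}" by (intro card_mono) auto
  moreover have "0 < card {j\<in>{..<n}. v j \<le> v i}" using i by (auto simp: card_gt_0_iff)
  ultimately show ?thesis by (simp add: obs_rank_def)
qed

lemma bij_betw_obs_rank:
  assumes "inj_on v {..<n}"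
  shows "bij_betw (obs_rank n v) {..<n} {1..n}"
proof -
  have inj: "inj_on (obs_rank n v) {..<n}"
  proof (rule inj_onI)
    fix i j assume ij: "i \<in> {..<n}" "j \<in> {..<n}" "obs_rank n v i = obs_rank n v j"
    then have "v i = v j"
      using obs_rank_le_iff[of i n j v] obs_rank_le_iff[of j n i v] by simp
    with assms show "i = j" using ij(1,2) by (rule inj_onD)
  qed
  moreover have "obs_rank n v ` {..<n} = {1..n}"
    using obs_rank_in_range inj by (intro card_subset_eq) (auto simp: card_image)
  ultimately show ?thesis by (simp add: bij_betw_def)
qed

lemma card_obs_rank_in:
  assumes "inj_on v {..<n}" "X \<subseteq> {1..n}"
  shows "card {i\<in>{..<n}. obs_rank n v i \<in> X} = card X"
proof -
  have b: "bij_betw (obs_rank n v) {..<n} {1..n}" by (rule bij_betw_obs_rank[OF assms(1)])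
  have "obs_rank n v ` {i\<in>{..<n}. obs_rank n v i \<in> X} = X"
    using b assms(2) by (fastforce simp: bij_betw_def)
  then show ?thesis
    using card_image[OF inj_on_subset[of "obs_rank n v" "{..<n}" "{i\<in>{..<n}. obs_rank n v i \<in> X}"]] b
    by (simp add: bij_betw_def subset_iff)
qed

text \<open>Links the counting ranks to the sorted list at its two ends, which is where the
  conditioning event reads the statuses.\<close>

lemma obs_rank_sort_key:
  fixes v :: "nat \<Rightarrow> real"
  assumes "inj_on v {..<n}" "0 < n"
  shows "obs_rank n v (sort_key v [0..<n] ! 0) = 1" "obs_rank n v (sort_key v [0..<n] ! (n - 1)) = n"
proof -
  have b: "obs_rank n v ` {..<n} = {1..n}" using bij_betw_obs_rank[OF assms(1)] by (simp add: bij_betw_def)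
  have l: "sort_key v [0..<n] ! 0 < n" "sort_key v [0..<n] ! (n - 1) < n"
    using assms(2) by (auto intro!: sort_key_nth_less)
  have "1 \<in> obs_rank n v ` {..<n}" "n \<in> obs_rank n v ` {..<n}" unfolding b using assms(2) by auto
  then obtain i j where ij: "i < n" "obs_rank n v i = 1" "j < n" "obs_rank n v j = n" by auto
  show "obs_rank n v (sort_key v [0..<n] ! 0) = 1"
    using obs_rank_in_range[OF l(1), of v] sort_key_nth_bounds(1)[OF ij(1), of v] ij
      obs_rank_le_iff[OF l(1) ij(1), of v] by simp
  show "obs_rank n v (sort_key v [0..<n] ! (n - 1)) = n"
    using obs_rank_in_range[OF l(2), of v] sort_key_nth_bounds(2)[OF ij(3), of v] ij
      obs_rank_le_iff[OF ij(3) l(2), of v] by simp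
qed

text \<open>\<open>S\<close> collects the ranks whose status is prescribed by \<open>b\<close>; the
  other statuses are free. Distinctness of the times is part of the pattern so that ranks run
  bijectively through 1, ..., n.\<close>

definition rank_pattern :: "nat \<Rightarrow> nat set \<Rightarrow> (nat \<Rightarrow> bool) \<Rightarrow> (nat \<Rightarrow> real) \<Rightarrow> (nat \<Rightarrow> bool) \<Rightarrow> bool" where
  "rank_pattern n S b v d \<longleftrightarrow>
     inj_on v {..<n} \<and> (\<forall>i<n. obs_rank n v i \<in> S \<longrightarrow> d i = b (obs_rank n v i))"

lemma rank_pattern_order_status:
  assumes "rank_pattern n S b v d" "0 < n" "1 \<in> S" "n \<in> S"
  shows "order_status n v d 1 = b 1" "order_status n v d n = b n"
proof -
  let ?f = "\<lambda>k. sort_key v [0..<n] ! k"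
  have p: "inj_on v {..<n}" "\<And>i. i < n \<Longrightarrow> obs_rank n v i \<in> S \<Longrightarrow> d i = b (obs_rank n v i)"
    using assms(1) by (auto simp: rank_pattern_def)
  show "order_status n v d 1 = b 1"
    using p(2)[of "?f 0"] obs_rank_sort_key(1)[OF p(1)] assms sort_key_nth_less[of 0 n v]
    by (simp add: order_status_eq)
  show "order_status n v d n = b n"
    using p(2)[of "?f (n - 1)"] obs_rank_sort_key(2)[OF p(1)] assms sort_key_nth_less[of "n - 1" n v]
    by (simp add: order_status_eq)
qed

text \<open>Take for j the observation of rank K: its initial block has exactly K members, and only
  the one of rank 1 can have a true status.\<close>

lemma initial_mean_pattern:
  assumes p: "rank_pattern n S b v d" and K: "1 \<le> K" "K \<le> n" "{1..K} \<subseteq> S" and b: "\<forall>k\<in>{1..K}. b k = (k = 1)"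
  shows "\<exists>j<n. initial_mean n v d j \<le> 1 / K"
proof -
  have inj: "inj_on v {..<n}" using p by (simp add: rank_pattern_def)
  obtain j where j: "j < n" "obs_rank n v j = K"
  proof -
    have "K \<in> obs_rank n v ` {..<n}" using bij_betw_obs_rank[OF inj] K by (simp add: bij_betw_def)
    then show thesis using that by auto
  qed
  have le: "v i \<le> v j \<longleftrightarrow> obs_rank n v i \<in> {1..K}" if "i < n" for i
    using obs_rank_le_iff[OF that j(1), of v] obs_rank_in_range[OF that, of v] j by simp
  have "{i\<in>{..<n}. v i \<le> v j} = {i\<in>{..<n}. obs_rank n v i \<in> {1..K}}" using le by auto
  then have N: "card {i\<in>{..<n}. v i \<le> v j} = K" using card_obs_rank_in[OF inj, of "{1..K}"] K by simp
  have "card {i\<in>{..<n}. v i \<le> v j \<and> d i} \<le> card {i\<in>{..<n}. obs_rank n v i \<in> {1}}"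
    using p le b K(3) by (intro card_mono) (auto simp: rank_pattern_def subset_iff)
  also have "\<dots> = 1" using card_obs_rank_in[OF inj, of "{1}"] K by simp
  finally have "initial_mean n v d j \<le> 1 / K"
    unfolding initial_mean_def N by (intro divide_right_mono) auto
  then show ?thesis using j(1) by blast
qed

text \<open>The observations weakly below and weakly above i cover the sample and share only i
  itself, so the two ranks add up to n + 1.\<close>

lemma obs_rank_uminus:
  assumes "inj_on v {..<n}" "i < n"
  shows "obs_rank n (\<lambda>i. - v i) i = n + 1 - obs_rank n v i"
proof -
  have "obs_rank n v i + obs_rank n (\<lambda>i. - v i) i =
     card ({j\<in>{..<n}. v j \<le> v i} \<union> {j\<in>{..<n}. - v j \<le> - v i}) + card ({j\<in>{..<n}. v j \<le> v i} \<inter> {j\<in>{..<n}. - v j \<le> - v i})"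
    unfolding obs_rank_def by (rule card_Un_Int) auto
  also have "{j\<in>{..<n}. v j \<le> v i} \<union> {j\<in>{..<n}. - v j \<le> - v i} = {..<n}" by auto
  also have "{j\<in>{..<n}. v j \<le> v i} \<inter> {j\<in>{..<n}. - v j \<le> - v i} = {i}"
    using assms by (auto dest: inj_onD)
  finally show ?thesis using obs_rank_in_range[OF assms(2)] by simp
qed

lemma rank_pattern_reflect:
  assumes "rank_pattern n S b v d" "S \<subseteq> {1..n}"
  shows "rank_pattern n ((\<lambda>k. n + 1 - k) ` S) (\<lambda>k. \<not> b (n + 1 - k)) (\<lambda>i. - v i) (\<lambda>i. \<not> d i)"
  unfolding rank_pattern_def
proof (intro conjI allI impI)
  have inj: "inj_on v {..<n}" using assms by (simp add: rank_pattern_def)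
  then show "inj_on (\<lambda>i. - v i) {..<n}" by (auto simp: inj_on_def)
  fix i assume i: "i < n" "obs_rank n (\<lambda>i. - v i) i \<in> (\<lambda>k. n + 1 - k) ` S"
  then obtain k where k: "k \<in> S" "n + 1 - obs_rank n v i = n + 1 - k"
    using obs_rank_uminus[OF inj i(1)] by auto
  \<comment> \<open>Truncated subtraction from n + 1 can be cancelled because both numbers lie in 1,
    ..., n.\<close>
  then have "obs_rank n v i = k" using obs_rank_in_range[OF i(1), of v] assms(2) by fastforce
  then show "(\<not> d i) = (\<not> b (n + 1 - obs_rank n (\<lambda>i. - v i) i))"
    using assms i k by (auto simp: obs_rank_uminus[OF inj i(1)] rank_pattern_def)
qed

section \<open>Measurability of order statuses, initial means and patterns\<close>

lemma measurable_insort_key: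
  fixes X :: "nat \<Rightarrow> 'a \<Rightarrow> real"
  assumes [measurable]: "\<And>i. X i \<in> borel_measurable N"
  shows "(\<lambda>\<omega>. insort_key (\<lambda>i. X i \<omega>) x ys) \<in> N \<rightarrow>\<^sub>M count_space UNIV"
proof (induction ys)
  case (Cons y ys)
  have "(\<lambda>\<omega>. y # insort_key (\<lambda>i. X i \<omega>) x ys) \<in> N \<rightarrow>\<^sub>M count_space UNIV"
    by (rule measurable_compose[OF Cons.IH]) simp
  then show ?case by simp
qed simp

text \<open>Both the keys and the list inserted into are random, but lists of naturals form a
  countable type, so measurability may be checked for each fixed list.\<close>

lemma measurable_sort_key:
  fixes X :: "nat \<Rightarrow> 'a \<Rightarrow> real"
  assumes "\<And>i. X i \<in> borel_measurable N"
  shows "(\<lambda>\<omega>. sort_key (\<lambda>i. X i \<omega>) xs) \<in> N \<rightarrow>\<^sub>M count_space UNIV"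
proof (induction xs)
  case (Cons x xs)
  then show ?case
    using measurable_compose_countable[OF measurable_insort_key[OF assms] Cons.IH] by simp
qed simp

lemma pred_order_status:
  fixes X :: "nat \<Rightarrow> 'a \<Rightarrow> real"
  assumes X: "\<And>i. X i \<in> borel_measurable N" and D: "\<And>i. Measurable.pred N (D i)"
    and k: "1 \<le> k" "k \<le> n"
  shows "Measurable.pred N (\<lambda>\<omega>. order_status n (\<lambda>i. X i \<omega>) (\<lambda>i. D i \<omega>) k)"
  unfolding order_status_eq[OF k]
proof (rule measurable_compose_countable[where f="D"])
  show "D i \<in> N \<rightarrow>\<^sub>M count_space UNIV" for i by (rule D)
  show "(\<lambda>\<omega>. sort_key (\<lambda>i. X i \<omega>) [0..<n] ! (k - 1)) \<in> N \<rightarrow>\<^sub>M count_space UNIV"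
    by (rule measurable_compose[OF measurable_sort_key[OF X]]) simp
qed

lemma measurable_initial_mean:
  fixes X :: "nat \<Rightarrow> 'a \<Rightarrow> real"
  assumes [measurable]: "\<And>i. X i \<in> borel_measurable N" "\<And>i. Measurable.pred N (D i)"
  shows "(\<lambda>\<omega>. initial_mean n (\<lambda>i. X i \<omega>) (\<lambda>i. D i \<omega>) j) \<in> borel_measurable N"
proof -
  have "(\<lambda>\<omega>. card {i\<in>{..<n}. X i \<omega> \<le> X j \<omega> \<and> D i \<omega>}) \<in> N \<rightarrow>\<^sub>M count_space UNIV"
       "(\<lambda>\<omega>. card {i\<in>{..<n}. X i \<omega> \<le> X j \<omega>}) \<in> N \<rightarrow>\<^sub>M count_space UNIV"
    by (rule measurable_card; simp)+
  note [measurable] = this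
  show ?thesis unfolding initial_mean_def by measurable
qed

text \<open>Only indices below n are required to be measurable, so the lemma also applies to the
  coordinates of a product over \<open>{..<n}\<close>.\<close>

lemma pred_rank_pattern:
  fixes X :: "nat \<Rightarrow> 'a \<Rightarrow> real"
  assumes [measurable]: "\<And>i. i < n \<Longrightarrow> X i \<in> borel_measurable N" "\<And>i. i < n \<Longrightarrow> Measurable.pred N (D i)"
  shows "Measurable.pred N (\<lambda>\<omega>. rank_pattern n S b (\<lambda>i. X i \<omega>) (\<lambda>i. D i \<omega>))"
proof -
  have r: "(\<lambda>\<omega>. obs_rank n (\<lambda>i. X i \<omega>) i) \<in> N \<rightarrow>\<^sub>M count_space UNIV" if i: "i < n" for i
    unfolding obs_rank_def
  proof (rule measurable_card)
    fix j
    show "{\<omega> \<in> space N. j \<in> {j \<in> {..<n}. X j \<omega> \<le> X i \<omega>}} \<in> sets N"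
      using i by (cases "j < n") simp_all
  qed
  have [measurable]: "Measurable.pred N (\<lambda>\<omega>. obs_rank n (\<lambda>i. X i \<omega>) i \<in> S)" if "i < n" for i
    using measurable_compose[OF r[OF that], of "\<lambda>k. k \<in> S"] by simp
  have [measurable]: "Measurable.pred N (\<lambda>\<omega>. b (obs_rank n (\<lambda>i. X i \<omega>) i))" if "i < n" for i
    using measurable_compose[OF r[OF that], of b] by simp
  have "Measurable.pred N (\<lambda>\<omega>. (\<forall>i\<in>{..<n}. \<forall>j\<in>{..<n}. X i \<omega> = X j \<omega> \<longrightarrow> i = j)
     \<and> (\<forall>i\<in>{..<n}. obs_rank n (\<lambda>i. X i \<omega>) i \<in> S \<longrightarrow> (D i \<omega> \<longleftrightarrow> b (obs_rank n (\<lambda>i. X i \<omega>) i))))"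
    by (intro pred_intros_logic pred_intros_finite; simp)
  then show ?thesis unfolding rank_pattern_def inj_on_def by (simp add: Ball_def)
qed

section \<open>Product laws and the probability of a pattern\<close>

text \<open>A sample of pairs can be generated by drawing all first and all second components separately;
  this makes it possible to condition on all examination times at once.\<close>

lemma distr_coupling_PiM:
  fixes A :: "'b measure" and B :: "'c measure"
  assumes I: "finite I" and "prob_space A" "prob_space B" and f[measurable]: "f \<in> B \<Otimes>\<^sub>M A \<rightarrow>\<^sub>M C"
  shows "distr (PiM I (\<lambda>_. B) \<Otimes>\<^sub>M PiM I (\<lambda>_. A)) (PiM I (\<lambda>_. C)) (\<lambda>(v, u). \<lambda>i\<in>I. f (v i, u i)) =
         PiM I (\<lambda>_. distr (B \<Otimes>\<^sub>M A) C f)"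
proof -
  interpret A: prob_space A by fact
  interpret B: prob_space B by fact
  interpret AB: pair_prob_space B A ..
  interpret PA: product_prob_space "\<lambda>_. A" I ..
  interpret PB: product_prob_space "\<lambda>_. B" I ..
  interpret D: prob_space "distr (B \<Otimes>\<^sub>M A) C f" by (rule AB.prob_space_distr) simp
  interpret PD: product_prob_space "\<lambda>_. distr (B \<Otimes>\<^sub>M A) C f" I ..
  let ?PA = "PiM I (\<lambda>_. A)" and ?PB = "PiM I (\<lambda>_. B)"
  let ?g = "\<lambda>(v, u). \<lambda>i\<in>I. f (v i, u i)"
  have g[measurable]: "?g \<in> ?PB \<Otimes>\<^sub>M ?PA \<rightarrow>\<^sub>M PiM I (\<lambda>_. C)"
    by (simp add: split_beta')
  show ?thesis
  proof (rule PD.PiM_eqI[OF I])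
    show "sets (distr (?PB \<Otimes>\<^sub>M ?PA) (PiM I (\<lambda>_. C)) ?g) = sets (PiM I (\<lambda>_. distr (B \<Otimes>\<^sub>M A) C f))"
      by (auto intro!: sets_PiM_cong)
    fix T assume "\<And>i. i \<in> I \<Longrightarrow> T i \<in> sets (distr (B \<Otimes>\<^sub>M A) C f)"
    then have T[measurable]: "\<And>i. i \<in> I \<Longrightarrow> T i \<in> sets C" by simp
    have PT: "Pi\<^sub>E I T \<in> sets (PiM I (\<lambda>_. C))" by (rule sets_PiM_I_finite[OF I T])
    let ?h = "\<lambda>i y. emeasure A (Pair y -` (f -` T i \<inter> space (B \<Otimes>\<^sub>M A)))"
    have fT: "f -` T i \<inter> space (B \<Otimes>\<^sub>M A) \<in> sets (B \<Otimes>\<^sub>M A)" if "i \<in> I" for i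
      using T[OF that] by (rule measurable_sets[OF f])
    have h: "?h i \<in> borel_measurable B" if "i \<in> I" for i
      using fT[OF that] by (rule A.measurable_emeasure_Pair)
    have "emeasure (distr (?PB \<Otimes>\<^sub>M ?PA) (PiM I (\<lambda>_. C)) ?g) (Pi\<^sub>E I T) =
        emeasure (?PB \<Otimes>\<^sub>M ?PA) (?g -` Pi\<^sub>E I T \<inter> space (?PB \<Otimes>\<^sub>M ?PA))"
      using PT by (intro emeasure_distr g)
    also have "\<dots> = (\<integral>\<^sup>+v. emeasure ?PA (Pair v -` (?g -` Pi\<^sub>E I T \<inter> space (?PB \<Otimes>\<^sub>M ?PA))) \<partial>?PB)"
      using PT by (intro PA.emeasure_pair_measure_alt measurable_sets[OF g])
    also have "\<dots> = (\<integral>\<^sup>+v. (\<Prod>i\<in>I. ?h i (v i)) \<partial>?PB)"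
    proof (rule nn_integral_cong)
      fix v assume v: "v \<in> space ?PB"
      \<comment> \<open>For fixed first components the section is a box, so its measure factors over
        the coordinates; the integral over v then factors as well.\<close>
      have "Pair v -` (?g -` Pi\<^sub>E I T \<inter> space (?PB \<Otimes>\<^sub>M ?PA)) =
         Pi\<^sub>E I (\<lambda>i. Pair (v i) -` (f -` T i \<inter> space (B \<Otimes>\<^sub>M A)))"
        using v by (fastforce simp: space_pair_measure space_PiM PiE_iff Pi_iff extensional_def)
      then show "emeasure ?PA (Pair v -` (?g -` Pi\<^sub>E I T \<inter> space (?PB \<Otimes>\<^sub>M ?PA))) = (\<Prod>i\<in>I. ?h i (v i))"
        using fT by (simp only:) (intro PA.emeasure_PiM[OF I] sets_Pair1)
    qed
    also have "\<dots> = (\<Prod>i\<in>I. \<integral>\<^sup>+y. ?h i y \<partial>B)"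
      using h by (intro PB.product_nn_integral_prod[OF I])
    also have "\<dots> = (\<Prod>i\<in>I. emeasure (distr (B \<Otimes>\<^sub>M A) C f) (T i))"
      using fT T by (intro prod.cong refl) (simp add: A.emeasure_pair_measure_alt emeasure_distr)
    finally show "emeasure (distr (?PB \<Otimes>\<^sub>M ?PA) (PiM I (\<lambda>_. C)) ?g) (Pi\<^sub>E I T) =
      (\<Prod>i\<in>I. emeasure (distr (B \<Otimes>\<^sub>M A) C f) (T i))" .
  qed
qed

text \<open>The complement of the support is the union of all open null sets, and second
  countability reduces it to a countable union.\<close>

lemma AE_topological_support:
  fixes N :: "'a::second_countable_topology measure"
  assumes "sets N = sets borel"
  shows "AE x in N. x \<in> topological_support N"
proof -
  let ?F = "{S. open S \<and> emeasure N S = 0}"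
  obtain F' where F': "F' \<subseteq> ?F" "countable F'" "\<Union>F' = \<Union>?F"
    by (rule Lindelof[of ?F]) auto
  have "(\<Union>S\<in>F'. S) \<in> null_sets N"
    using F' assms by (intro null_sets_UN') (auto simp: null_sets_def)
  then have "\<Union>?F \<in> null_sets N" using F'(3) by simp
  moreover have "{x \<in> space N. x \<notin> topological_support N} \<subseteq> \<Union>?F"
    by (auto simp: topological_support_def)
  ultimately show ?thesis by (rule AE_I')
qed

text \<open>By Fubini for the pair of coordinates i and j, the diagonal has measure \<integral> N{x}
  dN(x), which is 0 without atoms. The result is carried to the full product by restriction.\<close>

lemma AE_PiM_components_distinct:
  fixes N :: "real measure"
  assumes "prob_space N" and N[measurable_cong]: "sets N = sets borel" and atom: "\<And>x. emeasure N {x} = 0"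
    and I: "finite I" "i \<in> I" "j \<in> I" "i \<noteq> j"
  shows "AE v in PiM I (\<lambda>_. N). v i \<noteq> v j"
proof -
  interpret N: prob_space N by fact
  interpret P: product_prob_space "\<lambda>_. N" I ..
  interpret P2: prob_space "PiM {i, j} (\<lambda>_. N)"
    by (rule prob_space_PiM) (rule assms(1))
  have pm[measurable]: "case_prod (\<lambda>x y. of_bool (x = y)) \<in> borel_measurable (N \<Otimes>\<^sub>M N)"
    by measurable
  have "(\<integral>\<^sup>+v. of_bool (v i = v j) \<partial>PiM {i, j} (\<lambda>_. N)) = (\<integral>\<^sup>+z. of_bool (fst z = snd z) \<partial>(N \<Otimes>\<^sub>M N))"
    by (rule P.product_nn_integral_pair[OF pm I(4)])
  also have "\<dots> = (\<integral>\<^sup>+x. \<integral>\<^sup>+y. of_bool (x = y) \<partial>N \<partial>N)"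
    using pm by (subst N.nn_integral_fst[symmetric]) (auto simp: split_beta')
  also have "\<dots> = (\<integral>\<^sup>+x. emeasure N {x} \<partial>N)"
  proof (rule nn_integral_cong)
    fix x
    have "(\<integral>\<^sup>+y. of_bool (x = y) \<partial>N) = (\<integral>\<^sup>+y. indicator {x} y \<partial>N)"
      by (intro nn_integral_cong) (auto simp: indicator_def)
    then show "(\<integral>\<^sup>+y. of_bool (x = y) \<partial>N) = emeasure N {x}" by (simp add: N)
  qed
  finally have "(\<integral>\<^sup>+v. of_bool (v i = v j) \<partial>PiM {i, j} (\<lambda>_. N)) = 0" by (simp add: atom)
  then have "AE v in PiM {i, j} (\<lambda>_. N). of_bool (v i = v j) = (0::ennreal)"
    by (subst (asm) nn_integral_0_iff_AE) auto
  then have "AE v in PiM {i, j} (\<lambda>_. N). v i \<noteq> v j"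
    by (rule eventually_mono) auto
  moreover have "PiM {i, j} (\<lambda>_. N) = distr (PiM I (\<lambda>_. N)) (PiM {i, j} (\<lambda>_. N)) (\<lambda>v. restrict v {i, j})"
    using I by (intro P.distr_restrict) simp_all
  ultimately have "AE v in distr (PiM I (\<lambda>_. N)) (PiM {i, j} (\<lambda>_. N)) (\<lambda>v. restrict v {i, j}). v i \<noteq> v j"
    by (simp only:)
  then have "AE v in PiM I (\<lambda>_. N). restrict v {i, j} i \<noteq> restrict v {i, j} j"
    using I by (intro AE_distrD[OF measurable_restrict_subset]) simp_all
  then show ?thesis by simp
qed

lemma prod_obs_rank_power:
  assumes "inj_on v {..<n}" "S \<subseteq> {1..n}"
  shows "(\<Prod>i<n. if obs_rank n v i \<in> S then r else 1) = (r :: 'a :: comm_semiring_1) ^ card S"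
proof -
  have "(\<Prod>i<n. if obs_rank n v i \<in> S then r else 1) = (\<Prod>k\<in>{1..n}. if k \<in> S then r else 1)"
    by (rule prod.reindex_bij_betw[OF bij_betw_obs_rank[OF assms(1)]])
  also have "\<dots> = (\<Prod>k\<in>{1..n} \<inter> S. r)" by (rule prod.inter_restrict[symmetric]) simp
  also have "{1..n} \<inter> S = S" using assms(2) by auto
  finally show ?thesis by simp
qed

text \<open>Points of a finite product agree with the full sequences only below n, so the pattern
  must not see other indices.\<close>

lemma rank_pattern_cong:
  assumes "\<And>i. i < n \<Longrightarrow> v i = v' i" "\<And>i. i < n \<Longrightarrow> d i = d' i"
  shows "rank_pattern n S b v d = rank_pattern n S b v' d'"
proof -
  have "obs_rank n v i = obs_rank n v' i" if "i < n" for i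
    unfolding obs_rank_def using assms(1) that by (intro arg_cong[where f=card]) auto
  moreover have "inj_on v {..<n} = inj_on v' {..<n}" using assms(1) by (intro inj_on_cong) auto
  ultimately show ?thesis using assms(2) unfolding rank_pattern_def by auto
qed

text \<open>With the times fixed, the pattern contains a box in the space of the variables U, whose
  measure is at least r to the number of prescribed ranks for almost every choice of times.
  Integrating over the times keeps this bound.\<close>

lemma rank_pattern_prob_ge:
  fixes NU NV :: "real measure"
  assumes "prob_space NU" "prob_space NV"
    and sU[measurable_cong]: "sets NU = sets borel" and sV[measurable_cong]: "sets NV = sets borel"
    and atom: "\<And>x. emeasure NV {x} = 0" and range: "AE y in NV. l \<le> y \<and> y \<le> u"
    and r: "ennreal r \<le> emeasure NU {..l}" "ennreal r \<le> emeasure NU {u<..}" "0 \<le> r"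
    and S: "S \<subseteq> {1..n}"
  defines "K \<equiv> distr (NV \<Otimes>\<^sub>M NU) (borel \<Otimes>\<^sub>M count_space UNIV) (\<lambda>(y, x). (y, x \<le> y))"
  shows "ennreal (r ^ card S) \<le> emeasure (PiM {..<n} (\<lambda>_. K))
     {w \<in> space (PiM {..<n} (\<lambda>_. K)). rank_pattern n S b (\<lambda>i. fst (w i)) (\<lambda>i. snd (w i))}"
proof -
  interpret U: prob_space NU by fact
  interpret V: prob_space NV by fact
  interpret PU: product_prob_space "\<lambda>_. NU" "{..<n}" ..
  interpret V': prob_space "PiM {..<n} (\<lambda>_. NV)" by (rule prob_space_PiM) (rule assms(2))
  interpret U': prob_space "PiM {..<n} (\<lambda>_. NU)" by (rule prob_space_PiM) (rule assms(1))
  let ?C = "(borel :: real measure) \<Otimes>\<^sub>M (count_space UNIV :: bool measure)"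
  let ?P = "PiM {..<n} (\<lambda>_. ?C)" and ?PV = "PiM {..<n} (\<lambda>_. NV)" and ?PU = "PiM {..<n} (\<lambda>_. NU)"
  let ?f = "\<lambda>(y, x). (y, x \<le> y) :: real \<times> bool"
  let ?g = "\<lambda>(v, u). \<lambda>i\<in>{..<n}. ?f (v i, u i)"
  let ?E = "{w \<in> space ?P. rank_pattern n S b (\<lambda>i. fst (w i)) (\<lambda>i. snd (w i))}"
  have f: "?f \<in> NV \<Otimes>\<^sub>M NU \<rightarrow>\<^sub>M ?C"
    by (simp add: split_beta')
  have g: "?g \<in> ?PV \<Otimes>\<^sub>M ?PU \<rightarrow>\<^sub>M ?P"
  proof -
    have "?g = (\<lambda>x. \<lambda>i\<in>{..<n}. ?f (fst x i, snd x i))" by auto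
    also have "\<dots> \<in> ?PV \<Otimes>\<^sub>M ?PU \<rightarrow>\<^sub>M ?P"
      by (intro measurable_restrict measurable_compose[OF _ f] measurable_Pair
        measurable_compose[OF measurable_fst] measurable_compose[OF measurable_snd] measurable_component_singleton)
    finally show ?thesis .
  qed
  have E: "?E \<in> sets ?P"
  proof -
    have "Measurable.pred ?P (\<lambda>w. rank_pattern n S b (\<lambda>i. fst (w i)) (\<lambda>i. snd (w i)))"
      by (rule pred_rank_pattern) simp_all
    then show ?thesis by simp
  qed
  let ?D = "?g -` ?E \<inter> space (?PV \<Otimes>\<^sub>M ?PU)"
  have D: "?D \<in> sets (?PV \<Otimes>\<^sub>M ?PU)" by (rule measurable_sets[OF g E])
  have K: "PiM {..<n} (\<lambda>_. K) = distr (?PV \<Otimes>\<^sub>M ?PU) ?P ?g"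
    unfolding K_def using assms(1,2) f by (intro distr_coupling_PiM[symmetric]) simp_all
  have "AE v in ?PV. \<forall>i\<in>{..<n}. l \<le> v i \<and> v i \<le> u"
    by (intro AE_finite_allI AE_PiM_component[OF assms(2) _ range]) simp_all
  moreover have "AE v in ?PV. \<forall>i\<in>{..<n}. \<forall>j\<in>{..<n}. v i = v j \<longrightarrow> i = j"
  proof (intro AE_finite_allI)
    fix i j assume ij: "i \<in> {..<n}" "j \<in> {..<n}"
    show "AE v in ?PV. v i = v j \<longrightarrow> i = j"
    proof (cases "i = j")
      case False
      have "AE v in ?PV. v i \<noteq> v j"
        by (rule AE_PiM_components_distinct[OF assms(2) sV atom _ ij False]) simp
      then show ?thesis by (rule eventually_mono) simp
    qed simp
  qed auto
  moreover have "AE v in ?PV. v \<in> space ?PV" by (rule AE_space)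
  ultimately have "AE v in ?PV. ennreal (r ^ card S) \<le> emeasure ?PU (Pair v -` ?D)"
  proof (eventually_elim, goal_cases)
    case (1 v)
    have inj: "inj_on v {..<n}" using 1(2) by (auto simp: inj_on_def)
    \<comment> \<open>All times lie in [l, u], so x \<le> l forces the status true and x > u forces
      it false, whatever the time is.\<close>
    let ?box = "\<lambda>i. if obs_rank n v i \<in> S then if b (obs_rank n v i) then {..l} else {u<..} else UNIV"
    have spU: "space NU = UNIV" and spV: "space NV = UNIV"
      using sets_eq_imp_space_eq[OF sU] sets_eq_imp_space_eq[OF sV] by simp_all
    have "Pi\<^sub>E {..<n} ?box \<subseteq> Pair v -` ?D"
    proof
      fix x assume x: "x \<in> Pi\<^sub>E {..<n} ?box"
      have "x i \<le> v i \<longleftrightarrow> b (obs_rank n v i)" if "i < n" "obs_rank n v i \<in> S" for i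
      proof -
        have "x i \<in> ?box i" using x that(1) by (auto simp: PiE_iff)
        moreover have "l \<le> v i" "v i \<le> u" using 1(1) that(1) by auto
        ultimately show ?thesis using that(2) by (cases "b (obs_rank n v i)") auto
      qed
      then have "rank_pattern n S b v (\<lambda>i. x i \<le> v i)" using inj by (simp add: rank_pattern_def)
      then have "rank_pattern n S b (\<lambda>i. fst (?g (v, x) i)) (\<lambda>i. snd (?g (v, x) i))"
        by (rule rank_pattern_cong[THEN iffD1, rotated 2]) simp_all
      moreover have "(v, x) \<in> space (?PV \<Otimes>\<^sub>M ?PU)"
        using x 1(3) unfolding space_pair_measure space_PiM by (auto simp: PiE_iff spU)
      moreover from this have "?g (v, x) \<in> space ?P" by (rule measurable_space[OF g])
      ultimately show "x \<in> Pair v -` ?D" by simp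
    qed
    moreover have "Pair v -` ?D \<in> sets ?PU" using D by (rule sets_Pair1)
    ultimately have "emeasure ?PU (Pi\<^sub>E {..<n} ?box) \<le> emeasure ?PU (Pair v -` ?D)"
      by (rule emeasure_mono)
    moreover have "ennreal (r ^ card S) \<le> emeasure ?PU (Pi\<^sub>E {..<n} ?box)"
    proof -
      have "ennreal (r ^ card S) = (\<Prod>i<n. if obs_rank n v i \<in> S then ennreal r else 1)"
        using prod_obs_rank_power[OF inj S, of "ennreal r"] r(3) by (simp only: ennreal_power)
      also have "\<dots> \<le> (\<Prod>i<n. emeasure NU (?box i))"
      proof (rule prod_mono_ennreal)
        fix i
        show "(if obs_rank n v i \<in> S then ennreal r else 1) \<le> emeasure NU (?box i)"
          using r(1,2) U.emeasure_space_1 unfolding spU by simp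
      qed
      also have "\<dots> = emeasure ?PU (Pi\<^sub>E {..<n} ?box)"
        by (intro PU.emeasure_PiM[symmetric]) (auto simp: sU)
      finally show ?thesis .
    qed
    ultimately show ?case by (rule order_trans[rotated])
  qed
  then have "(\<integral>\<^sup>+v. ennreal (r ^ card S) \<partial>?PV) \<le> (\<integral>\<^sup>+v. emeasure ?PU (Pair v -` ?D) \<partial>?PV)"
    by (rule nn_integral_mono_AE)
  then have "ennreal (r ^ card S) \<le> (\<integral>\<^sup>+v. emeasure ?PU (Pair v -` ?D) \<partial>?PV)"
    by (simp add: V'.emeasure_space_1)
  also have "\<dots> = emeasure (?PV \<Otimes>\<^sub>M ?PU) ?D"
    using D by (rule PU.emeasure_pair_measure_alt[symmetric])
  also have "\<dots> = emeasure (PiM {..<n} (\<lambda>_. K)) ?E"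
    unfolding K by (rule emeasure_distr[OF g E, symmetric])
  also have "?E = {w \<in> space (PiM {..<n} (\<lambda>_. K)). rank_pattern n S b (\<lambda>i. fst (w i)) (\<lambda>i. snd (w i))}"
    unfolding K by simp
  finally show ?thesis .
qed

text \<open>Conditioning divides by a number at most 1. If the condition has probability 0, the
  quotient is 0 by convention, but so is the left-hand side.\<close>

lemma cond_prob_ge_prob_Int:
  assumes "prob_space M" "{x \<in> space M. P x \<and> Q x} \<in> sets M" "{x \<in> space M. Q x} \<in> sets M"
  shows "\<P>(x in M. P x \<and> Q x) \<le> \<P>(x in M. P x \<bar> Q x)"
proof -
  interpret prob_space M by fact
  have "prob {x \<in> space M. P x \<and> Q x} \<le> prob {x \<in> space M. Q x}"
    using assms by (intro finite_measure_mono) auto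
  moreover have "prob {x \<in> space M. Q x} \<le> 1" by simp
  ultimately show ?thesis
    unfolding cond_prob_def
    by (cases "prob {x \<in> space M. Q x} = 0")
      (auto simp: le_divide_eq zero_less_measure_iff intro!: mult_right_le_one_le)
qed

lemma order_stat_extremal:
  assumes "is_npmle n v d G" "1 \<le> n"
  shows "G (order_stat n v d 1) \<le> c \<longleftrightarrow> (\<exists>j<n. initial_mean n v d j \<le> c)"
    and "c \<le> G (order_stat n v d n) \<longleftrightarrow> (\<exists>j<n. initial_mean n (\<lambda>i. - v i) (\<lambda>i. \<not> d i) j \<le> 1 - c)"
proof -
  have k: "sort_key v [0..<n] ! 0 < n" "sort_key v [0..<n] ! (n - 1) < n"
    using assms(2) by (auto intro!: sort_key_nth_less)
  show "G (order_stat n v d 1) \<le> c \<longleftrightarrow> (\<exists>j<n. initial_mean n v d j \<le> c)"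
    using npmle_at_Min_le_iff[OF assms(1) k(1) sort_key_nth_bounds(1)] assms(2) by (simp add: order_stat_eq)
  show "c \<le> G (order_stat n v d n) \<longleftrightarrow> (\<exists>j<n. initial_mean n (\<lambda>i. - v i) (\<lambda>i. \<not> d i) j \<le> 1 - c)"
    using npmle_at_Max_ge_iff[OF assms(1) k(2) sort_key_nth_bounds(2)] assms(2) by (simp add: order_stat_eq)
qed

lemma ex_nat_inverse_le:
  assumes "0 < c"
  shows "\<exists>K::nat. 1 \<le> K \<and> 1 / K \<le> (c :: real)"
proof -
  obtain k where "inverse (real (Suc k)) < c" using reals_Archimedean[OF assms] by blast
  then show ?thesis by (intro exI[of _ "Suc k"]) (auto simp: inverse_eq_divide)
qed

section \<open>The current status model and its two limit statements\<close>

locale current_status = prob_space M for M :: "'a measure" +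
  fixes U V :: "'a \<Rightarrow> real"
    and Vs :: "nat \<Rightarrow> 'a \<Rightarrow> real"
    and \<Delta>s :: "nat \<Rightarrow> 'a \<Rightarrow> bool"
    and G0 :: "real \<Rightarrow> real"
    and Ghat :: "nat \<Rightarrow> 'a \<Rightarrow> real \<Rightarrow> real"
    and lv uv :: real
  assumes UV_indep: "indep_var borel U borel V"
    and iid_indep: "indep_vars (\<lambda>_. borel \<Otimes>\<^sub>M count_space UNIV)
                      (\<lambda>i \<omega>. (Vs i \<omega>, \<Delta>s i \<omega>)) UNIV"
    and iid_copies: "\<And>i. distr M (borel \<Otimes>\<^sub>M count_space UNIV) (\<lambda>\<omega>. (Vs i \<omega>, \<Delta>s i \<omega>)) =
                        distr M (borel \<Otimes>\<^sub>M count_space UNIV) (\<lambda>\<omega>. (V \<omega>, U \<omega> \<le> V \<omega>))"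
    and G0_cdf: "G0 = cdf (distr M borel U)"
    and V_cont: "continuous_on UNIV (cdf (distr M borel V))"
    and V_support: "topological_support (distr M borel V) = {lv..uv}"
    and G0_bounds: "0 < G0 lv" "G0 uv < 1"
    and Ghat_npmle: "\<And>n \<omega>. \<lbrakk>1 \<le> n; \<omega> \<in> space M\<rbrakk> \<Longrightarrow>
                       is_npmle n (\<lambda>i. Vs i \<omega>) (\<lambda>i. \<Delta>s i \<omega>) (Ghat n \<omega>)"
begin

lemma rv_UV[measurable]: "U \<in> borel_measurable M" "V \<in> borel_measurable M"
  using UV_indep by (auto dest: indep_var_rv1 indep_var_rv2)

lemma rv_pair: "(\<lambda>\<omega>. (Vs i \<omega>, \<Delta>s i \<omega>)) \<in> M \<rightarrow>\<^sub>M borel \<Otimes>\<^sub>M count_space UNIV"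
  using iid_indep by (auto simp: indep_vars_def)

lemma rv_Vs[measurable]: "Vs i \<in> borel_measurable M"
  using measurable_compose[OF rv_pair measurable_fst] by simp

lemma rv_\<Delta>s[measurable]: "Measurable.pred M (\<Delta>s i)"
  using measurable_compose[OF rv_pair measurable_snd] by simp

definition NU :: "real measure" where "NU = distr M borel U"
definition NV :: "real measure" where "NV = distr M borel V"

definition obs_law :: "(real \<times> bool) measure" where
  "obs_law = distr (NV \<Otimes>\<^sub>M NU) (borel \<Otimes>\<^sub>M count_space UNIV) (\<lambda>(y, x). (y, x \<le> y))"

lemma prob_space_NU: "prob_space NU"
  unfolding NU_def by (rule prob_space_distr) simp

lemma prob_space_NV: "prob_space NV"
  unfolding NV_def by (rule prob_space_distr) simp

lemma sets_NU[measurable_cong]: "sets NU = sets borel" and sets_NV[measurable_cong]: "sets NV = sets borel"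
  by (simp_all add: NU_def NV_def)

lemma distr_pair_eq_obs_law:
  "distr M (borel \<Otimes>\<^sub>M count_space UNIV) (\<lambda>\<omega>. (Vs i \<omega>, \<Delta>s i \<omega>)) = obs_law"
proof -
  interpret U: prob_space NU by (rule prob_space_NU)
  interpret V: prob_space NV by (rule prob_space_NV)
  interpret VU: pair_prob_space NV NU ..
  have "NU \<Otimes>\<^sub>M NV = distr M (borel \<Otimes>\<^sub>M borel) (\<lambda>\<omega>. (U \<omega>, V \<omega>))"
    using UV_indep unfolding indep_var_distribution_eq NU_def NV_def by simp
  then have "NV \<Otimes>\<^sub>M NU = distr M (borel \<Otimes>\<^sub>M borel) (\<lambda>\<omega>. (V \<omega>, U \<omega>))"
    \<comment> \<open>Independence is given for (U, V), whereas an observation starts with the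
      examination time, hence the swap.\<close>
    by (subst VU.distr_pair_swap) (simp add: distr_distr comp_def split_beta' NU_def NV_def cong: distr_cong)
  then have "obs_law = distr M (borel \<Otimes>\<^sub>M count_space UNIV) (\<lambda>\<omega>. (V \<omega>, U \<omega> \<le> V \<omega>))"
    unfolding obs_law_def by (simp add: distr_distr comp_def split_beta')
  then show ?thesis using iid_copies by simp
qed

lemma distr_sample_eq_PiM:
  assumes "0 < n"
  shows "distr M (PiM {..<n} (\<lambda>_. borel \<Otimes>\<^sub>M count_space UNIV)) (\<lambda>\<omega>. \<lambda>i\<in>{..<n}. (Vs i \<omega>, \<Delta>s i \<omega>)) =
    PiM {..<n} (\<lambda>_. obs_law)"
proof -
  have "indep_vars (\<lambda>_. borel \<Otimes>\<^sub>M count_space UNIV) (\<lambda>i \<omega>. (Vs i \<omega>, \<Delta>s i \<omega>)) {..<n}"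
    using iid_indep by (rule indep_vars_subset) simp
  then show ?thesis
    using assms rv_pair by (subst (asm) indep_vars_iff_distr_eq_PiM) (auto simp: distr_pair_eq_obs_law)
qed

lemma measure_NU_atMost: "measure NU {..x} = G0 x"
  by (simp add: G0_cdf cdf_def NU_def)

definition r :: real where "r = min (G0 lv) (1 - G0 uv)"

lemma r_bounds: "0 < r" "r \<le> G0 lv" "r \<le> 1 - G0 uv"
  using G0_bounds by (auto simp: r_def)

lemma r_le_1: "r \<le> 1"
  using r_bounds(2) prob_space.prob_le_1[OF prob_space_NU, of "{..lv}"] by (simp add: measure_NU_atMost)

lemma r_le_NU: "ennreal r \<le> emeasure NU {..lv}" "ennreal r \<le> emeasure NU {uv<..}"
proof -
  interpret U: prob_space NU by (rule prob_space_NU)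
  show "ennreal r \<le> emeasure NU {..lv}"
    using r_bounds by (simp add: U.emeasure_eq_measure measure_NU_atMost)
  have "measure NU {uv<..} = 1 - measure NU {..uv}"
    using U.prob_compl[of "{..uv}"] by (simp add: NU_def Compl_eq_Diff_UNIV[symmetric])
  then show "ennreal r \<le> emeasure NU {uv<..}"
    using r_bounds by (simp add: U.emeasure_eq_measure measure_NU_atMost)
qed

lemma NV_no_atoms: "emeasure NV {x} = 0"
proof -
  interpret V: real_distribution NV unfolding NV_def by (rule real_distribution_distr) simp
  show ?thesis
    using V_cont V.isCont_cdf[of x] unfolding NV_def[symmetric]
    by (simp add: continuous_on_eq_continuous_at V.emeasure_eq_measure)
qed

lemma AE_NV_range: "AE y in NV. lv \<le> y \<and> y \<le> uv"
  using AE_topological_support[of NV] V_support by (auto simp: NV_def)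

lemma prob_rank_pattern_ge:
  assumes S: "S \<subseteq> {1..n}" and n: "0 < n"
  shows "r ^ card S \<le> \<P>(\<omega> in M. rank_pattern n S b (\<lambda>i. Vs i \<omega>) (\<lambda>i. \<Delta>s i \<omega>))"
proof -
  let ?X = "\<lambda>\<omega>. \<lambda>i\<in>{..<n}. (Vs i \<omega>, \<Delta>s i \<omega>)"
  let ?P = "PiM {..<n} (\<lambda>_. (borel :: real measure) \<Otimes>\<^sub>M (count_space UNIV :: bool measure))"
  have X: "?X \<in> M \<rightarrow>\<^sub>M ?P" using rv_pair by (intro measurable_restrict) auto
  let ?E = "{w \<in> space ?P. rank_pattern n S b (\<lambda>i. fst (w i)) (\<lambda>i. snd (w i))}"
  have "Measurable.pred ?P (\<lambda>w. rank_pattern n S b (\<lambda>i. fst (w i)) (\<lambda>i. snd (w i)))"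
    by (rule pred_rank_pattern) simp_all
  then have E: "?E \<in> sets ?P" by simp
  have "ennreal (r ^ card S) \<le> emeasure (PiM {..<n} (\<lambda>_. obs_law))
     {w \<in> space (PiM {..<n} (\<lambda>_. obs_law)). rank_pattern n S b (\<lambda>i. fst (w i)) (\<lambda>i. snd (w i))}"
    unfolding obs_law_def using r_bounds(1)
    by (intro rank_pattern_prob_ge[OF prob_space_NU prob_space_NV sets_NU sets_NV NV_no_atoms
          AE_NV_range r_le_NU _ S]) simp
  also have "\<dots> = emeasure (distr M ?P ?X) ?E" unfolding distr_sample_eq_PiM[OF n, symmetric] by simp
  also have "\<dots> = emeasure M (?X -` ?E \<inter> space M)" by (rule emeasure_distr[OF X E])
  also have "?X -` ?E \<inter> space M = {\<omega> \<in> space M. rank_pattern n S b (\<lambda>i. Vs i \<omega>) (\<lambda>i. \<Delta>s i \<omega>)}"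
  proof -
    have "rank_pattern n S b (\<lambda>i. fst (?X \<omega> i)) (\<lambda>i. snd (?X \<omega> i)) = rank_pattern n S b (\<lambda>i. Vs i \<omega>) (\<lambda>i. \<Delta>s i \<omega>)" for \<omega>
      by (rule rank_pattern_cong) auto
    then show ?thesis using measurable_space[OF X] by auto
  qed
  finally show ?thesis by (simp add: emeasure_eq_measure)
qed

lemma pred_sample_order_status:
  "1 \<le> k \<Longrightarrow> k \<le> n \<Longrightarrow> Measurable.pred M (\<lambda>\<omega>. order_status n (\<lambda>i. Vs i \<omega>) (\<lambda>i. \<Delta>s i \<omega>) k)"
  by (rule pred_order_status) auto

lemma pred_sample_rank_pattern[measurable]:
  "Measurable.pred M (\<lambda>\<omega>. rank_pattern n S b (\<lambda>i. Vs i \<omega>) (\<lambda>i. \<Delta>s i \<omega>))"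
  by (rule pred_rank_pattern) auto

text \<open>Common core of both ends. The number m is at once the sample size from which the pattern
  makes sense and a bound for the number of prescribed ranks; since r \<le> 1, the probability r^m
  is then a lower bound for all large n. Prescribing true at rank 1 and false at rank n makes the
  pattern imply the conditioning event.\<close>

lemma liminf_cond_prob_pos:
  assumes P: "\<And>n. 1 \<le> n \<Longrightarrow> {\<omega>\<in>space M. P n \<omega>} \<in> sets M"
    and S: "\<And>n. m \<le> n \<Longrightarrow> S n \<subseteq> {1..n} \<and> 1 \<in> S n \<and> n \<in> S n \<and> card (S n) \<le> m"
    and b: "\<And>n. m \<le> n \<Longrightarrow> b n 1 \<and> \<not> b n n"
    and imp: "\<And>n \<omega>. m \<le> n \<Longrightarrow> \<omega> \<in> space M \<Longrightarrow>
      rank_pattern n (S n) (b n) (\<lambda>i. Vs i \<omega>) (\<lambda>i. \<Delta>s i \<omega>) \<Longrightarrow> P n \<omega>"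
  shows "0 < liminf (\<lambda>n. ereal (\<P>(\<omega> in M. P n \<omega>
        \<bar> order_status n (\<lambda>i. Vs i \<omega>) (\<lambda>i. \<Delta>s i \<omega>) 1 \<and> \<not> order_status n (\<lambda>i. Vs i \<omega>) (\<lambda>i. \<Delta>s i \<omega>) n)))"
proof -
  have "r ^ m \<le> \<P>(\<omega> in M. P n \<omega>
      \<bar> order_status n (\<lambda>i. Vs i \<omega>) (\<lambda>i. \<Delta>s i \<omega>) 1 \<and> \<not> order_status n (\<lambda>i. Vs i \<omega>) (\<lambda>i. \<Delta>s i \<omega>) n)" (is "_ \<le> cond_prob M _ ?Q")
    if n: "max 1 m \<le> n" for n
  proof -
    have n1: "1 \<le> n" "m \<le> n" using n by auto
    have [measurable]: "Measurable.pred M (P n)" using P[OF n1(1)] by (simp add: pred_def)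
    have Q[measurable]: "Measurable.pred M ?Q"
      using pred_sample_order_status[of 1 n] pred_sample_order_status[of n n] n1 by simp
    have "r ^ m \<le> r ^ card (S n)"
      using S[OF n1(2)] r_bounds(1) r_le_1 by (intro power_decreasing) auto
    also have "\<dots> \<le> \<P>(\<omega> in M. rank_pattern n (S n) (b n) (\<lambda>i. Vs i \<omega>) (\<lambda>i. \<Delta>s i \<omega>))"
      using S[OF n1(2)] n1 by (intro prob_rank_pattern_ge) auto
    also have "\<dots> \<le> \<P>(\<omega> in M. P n \<omega> \<and> ?Q \<omega>)"
    proof (rule finite_measure_mono)
      show "{\<omega> \<in> space M. rank_pattern n (S n) (b n) (\<lambda>i. Vs i \<omega>) (\<lambda>i. \<Delta>s i \<omega>)} \<subseteq> {\<omega> \<in> space M. P n \<omega> \<and> ?Q \<omega>}"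
        using imp[OF n1(2)] rank_pattern_order_status[of n "S n" "b n"] S[OF n1(2)] b[OF n1(2)] n1 by auto
    qed measurable
    also have "\<dots> \<le> cond_prob M (P n) ?Q"
      by (rule cond_prob_ge_prob_Int[OF prob_space_axioms]) measurable
    finally show ?thesis .
  qed
  then have "ereal (r ^ m) \<le> liminf (\<lambda>n. ereal (\<P>(\<omega> in M. P n \<omega>
      \<bar> order_status n (\<lambda>i. Vs i \<omega>) (\<lambda>i. \<Delta>s i \<omega>) 1 \<and> \<not> order_status n (\<lambda>i. Vs i \<omega>) (\<lambda>i. \<Delta>s i \<omega>) n)))"
    by (intro Liminf_bounded eventually_sequentiallyI[of "max 1 m"]) auto
  moreover have "0 < ereal (r ^ m)" using r_bounds(1) by simp
  ultimately show ?thesis by (rule less_le_trans[rotated])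
qed

lemma sets_initial_mean_le:
  "{\<omega> \<in> space M. \<exists>j<n. initial_mean n (\<lambda>i. Vs i \<omega>) (\<lambda>i. \<Delta>s i \<omega>) j \<le> c} \<in> sets M"
  "{\<omega> \<in> space M. \<exists>j<n. initial_mean n (\<lambda>i. - Vs i \<omega>) (\<lambda>i. \<not> \<Delta>s i \<omega>) j \<le> c} \<in> sets M"
proof -
  have [measurable]: "(\<lambda>\<omega>. initial_mean n (\<lambda>i. Vs i \<omega>) (\<lambda>i. \<Delta>s i \<omega>) j) \<in> borel_measurable M"
    "(\<lambda>\<omega>. initial_mean n (\<lambda>i. - Vs i \<omega>) (\<lambda>i. \<not> \<Delta>s i \<omega>) j) \<in> borel_measurable M" for j
    by (rule measurable_initial_mean; simp)+
  show "{\<omega> \<in> space M. \<exists>j<n. initial_mean n (\<lambda>i. Vs i \<omega>) (\<lambda>i. \<Delta>s i \<omega>) j \<le> c} \<in> sets M"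
    "{\<omega> \<in> space M. \<exists>j<n. initial_mean n (\<lambda>i. - Vs i \<omega>) (\<lambda>i. \<not> \<Delta>s i \<omega>) j \<le> c} \<in> sets M"
    by measurable
qed

lemma Ghat_first_le_iff:
  assumes "\<omega> \<in> space M" "1 \<le> n"
  shows "Ghat n \<omega> (order_stat n (\<lambda>i. Vs i \<omega>) (\<lambda>i. \<Delta>s i \<omega>) 1) \<le> c \<longleftrightarrow>
    (\<exists>j<n. initial_mean n (\<lambda>i. Vs i \<omega>) (\<lambda>i. \<Delta>s i \<omega>) j \<le> c)"
  by (rule order_stat_extremal(1)[OF Ghat_npmle[OF assms(2,1)] assms(2)])

lemma Ghat_last_ge_iff:
  assumes "\<omega> \<in> space M" "1 \<le> n"
  shows "Ghat n \<omega> (order_stat n (\<lambda>i. Vs i \<omega>) (\<lambda>i. \<Delta>s i \<omega>) n) \<ge> c \<longleftrightarrow>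
    (\<exists>j<n. initial_mean n (\<lambda>i. - Vs i \<omega>) (\<lambda>i. \<not> \<Delta>s i \<omega>) j \<le> 1 - c)"
  by (rule order_stat_extremal(2)[OF Ghat_npmle[OF assms(2,1)] assms(2)])

lemma liminf_Ghat_first:
  assumes "\<epsilon> \<in> {0<..<G0 lv}"
  shows "0 < liminf (\<lambda>n. ereal (\<P>(\<omega> in M. Ghat n \<omega> (order_stat n (\<lambda>i. Vs i \<omega>) (\<lambda>i. \<Delta>s i \<omega>) 1) \<le> G0 lv - \<epsilon>
        \<bar> order_status n (\<lambda>i. Vs i \<omega>) (\<lambda>i. \<Delta>s i \<omega>) 1 \<and> \<not> order_status n (\<lambda>i. Vs i \<omega>) (\<lambda>i. \<Delta>s i \<omega>) n)))"
proof -
  from assms obtain K :: nat where K: "1 \<le> K" "1 / K \<le> G0 lv - \<epsilon>" using ex_nat_inverse_le[of "G0 lv - \<epsilon>"] by auto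
  show ?thesis
  \<comment> \<open>K low ranks and the last one make at most K + 1 prescriptions. From n \<ge> K +
    1 on, rank n lies outside 1, ..., K and differs from 1, so it is prescribed false.\<close>
  proof (rule liminf_cond_prob_pos[of _ "Suc K" "\<lambda>n. insert n {1..K}" "\<lambda>n k. k = 1"])
    fix n :: nat
    assume "1 \<le> n"
    then have "{\<omega> \<in> space M. Ghat n \<omega> (order_stat n (\<lambda>i. Vs i \<omega>) (\<lambda>i. \<Delta>s i \<omega>) 1) \<le> G0 lv - \<epsilon>} =
       {\<omega> \<in> space M. \<exists>j<n. initial_mean n (\<lambda>i. Vs i \<omega>) (\<lambda>i. \<Delta>s i \<omega>) j \<le> G0 lv - \<epsilon>}"
      by (simp only: Ghat_first_le_iff cong: conj_cong)
    then show "{\<omega> \<in> space M. Ghat n \<omega> (order_stat n (\<lambda>i. Vs i \<omega>) (\<lambda>i. \<Delta>s i \<omega>) 1) \<le> G0 lv - \<epsilon>} \<in> sets M"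
      by (simp only: sets_initial_mean_le)
  next
    fix n \<omega> assume n: "Suc K \<le> n" "\<omega> \<in> space M"
      and pt: "rank_pattern n (insert n {1..K}) (\<lambda>k. k = 1) (\<lambda>i. Vs i \<omega>) (\<lambda>i. \<Delta>s i \<omega>)"
    have "\<exists>j<n. initial_mean n (\<lambda>i. Vs i \<omega>) (\<lambda>i. \<Delta>s i \<omega>) j \<le> 1 / K"
      by (rule initial_mean_pattern[OF pt]) (use K n in auto)
    then show "Ghat n \<omega> (order_stat n (\<lambda>i. Vs i \<omega>) (\<lambda>i. \<Delta>s i \<omega>) 1) \<le> G0 lv - \<epsilon>"
      using n K(2) by (subst Ghat_first_le_iff) (auto intro: order_trans)
  qed (use K in \<open>auto simp: card_insert_if\<close>)
qed

lemma liminf_Ghat_last: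
  assumes "\<epsilon> \<in> {0<..<1 - G0 uv}"
  shows "0 < liminf (\<lambda>n. ereal (\<P>(\<omega> in M. Ghat n \<omega> (order_stat n (\<lambda>i. Vs i \<omega>) (\<lambda>i. \<Delta>s i \<omega>) n) \<ge> G0 uv + \<epsilon>
        \<bar> order_status n (\<lambda>i. Vs i \<omega>) (\<lambda>i. \<Delta>s i \<omega>) 1 \<and> \<not> order_status n (\<lambda>i. Vs i \<omega>) (\<lambda>i. \<Delta>s i \<omega>) n)))"
proof -
  from assms obtain K :: nat where K: "1 \<le> K" "1 / K \<le> 1 - (G0 uv + \<epsilon>)" using ex_nat_inverse_le[of "1 - (G0 uv + \<epsilon>)"] by auto
  show ?thesis
  \<comment> \<open>Mirror image: the top K ranks are true except the last, and rank 1 is true.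
    After reflection the top ranks become 1, ..., K with true at rank 1 only.\<close>
  proof (rule liminf_cond_prob_pos[of _ "Suc K" "\<lambda>n. insert 1 {n + 1 - K..n}" "\<lambda>n k. k \<noteq> n"])
    fix n :: nat
    assume "1 \<le> n"
    then have "{\<omega> \<in> space M. Ghat n \<omega> (order_stat n (\<lambda>i. Vs i \<omega>) (\<lambda>i. \<Delta>s i \<omega>) n) \<ge> G0 uv + \<epsilon>} =
       {\<omega> \<in> space M. \<exists>j<n. initial_mean n (\<lambda>i. - Vs i \<omega>) (\<lambda>i. \<not> \<Delta>s i \<omega>) j \<le> 1 - (G0 uv + \<epsilon>)}"
      by (simp only: Ghat_last_ge_iff cong: conj_cong)
    then show "{\<omega> \<in> space M. Ghat n \<omega> (order_stat n (\<lambda>i. Vs i \<omega>) (\<lambda>i. \<Delta>s i \<omega>) n) \<ge> G0 uv + \<epsilon>} \<in> sets M"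
      by (simp only: sets_initial_mean_le)
  next
    fix n \<omega> assume n: "Suc K \<le> n" "\<omega> \<in> space M"
      and pt: "rank_pattern n (insert 1 {n + 1 - K..n}) (\<lambda>k. k \<noteq> n) (\<lambda>i. Vs i \<omega>) (\<lambda>i. \<Delta>s i \<omega>)"
    have "{1..K} \<subseteq> (\<lambda>k. n + 1 - k) ` insert 1 {n + 1 - K..n}"
    proof
      fix k assume "k \<in> {1..K}"
      then show "k \<in> (\<lambda>k. n + 1 - k) ` insert 1 {n + 1 - K..n}"
        using n by (intro image_eqI[of _ _ "n + 1 - k"]) auto
    qed
    then have "\<exists>j<n. initial_mean n (\<lambda>i. - Vs i \<omega>) (\<lambda>i. \<not> \<Delta>s i \<omega>) j \<le> 1 / K"
      by (intro initial_mean_pattern[OF rank_pattern_reflect[OF pt]]) (use K n in auto)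
    then show "Ghat n \<omega> (order_stat n (\<lambda>i. Vs i \<omega>) (\<lambda>i. \<Delta>s i \<omega>) n) \<ge> G0 uv + \<epsilon>"
      using n K(2) by (subst Ghat_last_ge_iff) (auto intro: order_trans)
  qed (use K in \<open>auto simp: card_insert_if\<close>)
qed

end

theorem theorem3:
  fixes M :: "'a measure"
    and U V :: "'a \<Rightarrow> real"
    and Vs :: "nat \<Rightarrow> 'a \<Rightarrow> real"
    and \<Delta>s :: "nat \<Rightarrow> 'a \<Rightarrow> bool"
    and G0 :: "real \<Rightarrow> real"
    and Ghat :: "nat \<Rightarrow> 'a \<Rightarrow> real \<Rightarrow> real"
    and lv uv :: real
  assumes "prob_space M"
    and UV_indep: "prob_space.indep_var M borel U borel V"
    and iid_indep: "prob_space.indep_vars M (\<lambda>_. borel \<Otimes>\<^sub>M count_space UNIV)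
                      (\<lambda>i \<omega>. (Vs i \<omega>, \<Delta>s i \<omega>)) UNIV"
    and iid_copies: "\<And>i. distr M (borel \<Otimes>\<^sub>M count_space UNIV) (\<lambda>\<omega>. (Vs i \<omega>, \<Delta>s i \<omega>)) =
                        distr M (borel \<Otimes>\<^sub>M count_space UNIV) (\<lambda>\<omega>. (V \<omega>, U \<omega> \<le> V \<omega>))"
    and G0_cdf: "G0 = cdf (distr M borel U)"
    and G0_cont: "continuous_on UNIV G0"
    and V_cont: "continuous_on UNIV (cdf (distr M borel V))"
    and lv_uv: "lv < uv"
    and V_support: "topological_support (distr M borel V) = {lv..uv}"
    and G0_bounds: "0 < G0 lv" "G0 lv \<le> G0 uv" "G0 uv < 1"
    and Ghat_npmle: "\<And>n \<omega>. \<lbrakk>1 \<le> n; \<omega> \<in> space M\<rbrakk> \<Longrightarrow>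
                       is_npmle n (\<lambda>i. Vs i \<omega>) (\<lambda>i. \<Delta>s i \<omega>) (Ghat n \<omega>)"
  shows "(\<forall>\<epsilon>\<in>{0<..<G0 lv}.
            0 < liminf (\<lambda>n. ereal (\<P>(\<omega> in M.
                  Ghat n \<omega> (order_stat n (\<lambda>i. Vs i \<omega>) (\<lambda>i. \<Delta>s i \<omega>) 1) \<le> G0 lv - \<epsilon>
                  \<bar> order_status n (\<lambda>i. Vs i \<omega>) (\<lambda>i. \<Delta>s i \<omega>) 1
                    \<and> \<not> order_status n (\<lambda>i. Vs i \<omega>) (\<lambda>i. \<Delta>s i \<omega>) n)))) \<and>
         (\<forall>\<epsilon>\<in>{0<..<1 - G0 uv}.
            0 < liminf (\<lambda>n. ereal (\<P>(\<omega> in M.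
                  Ghat n \<omega> (order_stat n (\<lambda>i. Vs i \<omega>) (\<lambda>i. \<Delta>s i \<omega>) n) \<ge> G0 uv + \<epsilon>
                  \<bar> order_status n (\<lambda>i. Vs i \<omega>) (\<lambda>i. \<Delta>s i \<omega>) 1
                    \<and> \<not> order_status n (\<lambda>i. Vs i \<omega>) (\<lambda>i. \<Delta>s i \<omega>) n))))"
proof -
  interpret current_status M U V Vs \<Delta>s G0 Ghat lv uv
    using assms by (auto simp: current_status_def current_status_axioms_def)
  show ?thesis using liminf_Ghat_first liminf_Ghat_last by blast
qed

end
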